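(* Let $R$ be a commutative unital ring, let $M$ be an $R$-module, let $\{\cdot,\cdot\}:R\times R\to M$ be an $M$-valued biderivation on $R$, and let $\Sigma\subseteq R\setminus\{0\}$ be a multiplicatively closed set. Then there is a unique extension of $\{\cdot,\cdot\}$ (along the natural maps $R\to\Sigma^{-1}R$ and $M\to\Sigma^{-1}M$) to a $\Sigma^{-1}M$-valued biderivation on $\Sigma^{-1}R$. Moreover, this is a lifting extension.
   Context: All rings are commutative and unital. For a ring $R$ and an $R$-module $M$, an $M$-valued biderivation on $R$ is a function $\{\cdot,\cdot\}:R\times R\to M$ such that for each $r\in R$ both $\{r,\cdot\}$ and $\{\cdot,r\}$ are $M$-valued derivations on $R$ (additive maps $d:R\to M$ with $d(xy)=x\,d(y)+y\,d(x)$). Given a ring homomorphism $\phi:R\to R'$, an $R'$-module $M'$ and an additive map $\psi:M\to M'$ with $\psi(rx)=\phi(r)\psi(x)$, an $M'$-valued biderivation on $R'$ extends an $M$-valued biderivation on $R$ (along $\phi,\psi$) if $\psi(\{r,s\})=\{\phi(r),\phi(s)\}$ for all $r,s\in R$. A bidifferential ideal pair of an $M$-valued biderivation on $R$ is a pair of ideals $I,J\subseteq R$ such that $\{I,R\}\subseteq IM$ and $\{R,J\}\subseteq JM$. An extension of an $M$-valued biderivation $\{\cdot,\cdot\}$ on $R$ to an $M'$-valued biderivation $\{\cdot,\cdot\}$ on $R'$, along a ring homomorphism $\phi:R\to R'$ and an additive map $\psi:M\to M'$ with $\psi(rx)=\phi(r)\psi(x)$ for all $r\in R$ and $x\in M$,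 is lifting if whenever $(I,J)$ is a bidifferential ideal pair for $(R,M,\{\cdot,\cdot\})$, then $(IR',JR')$ is a bidifferential ideal pair for $(R',M',\{\cdot,\cdot\})$, where $IR'$ denotes the ideal of $R'$ generated by $\phi(I)$ and similarly for $JR'$. *)

theory Defs
  imports "HOL-Algebra.Module" "HOL-Algebra.Ideal_Product"
begin

section \<open>Biderivations\<close>

definition derivation :: "('a, 'c) ring_scheme \<Rightarrow> ('a, 'm, 'd) module_scheme \<Rightarrow> ('a \<Rightarrow> 'm) \<Rightarrow> bool"
  where "derivation R M d \<longleftrightarrow>
    d \<in> carrier R \<rightarrow> carrier M \<and>
    (\<forall>x\<in>carrier R. \<forall>y\<in>carrier R. d (x \<oplus>\<^bsub>R\<^esub> y) = d x \<oplus>\<^bsub>M\<^esub> d y) \<and>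
    (\<forall>x\<in>carrier R. \<forall>y\<in>carrier R. d (x \<otimes>\<^bsub>R\<^esub> y) = x \<odot>\<^bsub>M\<^esub> d y \<oplus>\<^bsub>M\<^esub> y \<odot>\<^bsub>M\<^esub> d x)"

text \<open>
  A biderivation is a function defined on \<open>carrier R \<times> carrier R\<close> only. Taking it from the
  extensional function space makes equality of biderivations the equality of HOL functions,
  so that \<open>\<exists>!\<close> expresses uniqueness.
\<close>

locale biderivation = module R M
  for R :: "('a, 'c) ring_scheme" (structure)
    and M :: "('a, 'm, 'd) module_scheme" (structure)
    and D :: "'a \<times> 'a \<Rightarrow> 'm" +
  assumes funcset: "D \<in> carrier R \<times> carrier R \<rightarrow>\<^sub>E carrier M"
    and derivation_left: "r \<in> carrier R \<Longrightarrow> derivation R M (\<lambda>s. D (s, r))"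
    and derivation_right: "r \<in> carrier R \<Longrightarrow> derivation R M (\<lambda>s. D (r, s))"

definition semilinear ::
    "('a, 'c) ring_scheme \<Rightarrow> ('a, 'm, 'd) module_scheme \<Rightarrow> ('b, 'n, 'e) module_scheme \<Rightarrow>
     ('a \<Rightarrow> 'b) \<Rightarrow> ('m \<Rightarrow> 'n) \<Rightarrow> bool"
  where "semilinear R M M' \<phi> \<psi> \<longleftrightarrow>
    \<psi> \<in> carrier M \<rightarrow> carrier M' \<and>
    (\<forall>x\<in>carrier M. \<forall>y\<in>carrier M. \<psi> (x \<oplus>\<^bsub>M\<^esub> y) = \<psi> x \<oplus>\<^bsub>M'\<^esub> \<psi> y) \<and>
    (\<forall>r\<in>carrier R. \<forall>x\<in>carrier M. \<psi> (r \<odot>\<^bsub>M\<^esub> x) = \<phi> r \<odot>\<^bsub>M'\<^esub> \<psi> x)"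

locale biderivation_extension =
  source: biderivation R M D + target: biderivation R' M' D'
  for R :: "('a, 'c) ring_scheme" and M :: "('a, 'm, 'd) module_scheme" and D
    and R' :: "('b, 'e) ring_scheme" and M' :: "('b, 'n, 'f) module_scheme" and D'
    and \<phi> :: "'a \<Rightarrow> 'b" and \<psi> :: "'m \<Rightarrow> 'n" +
  assumes ring_hom: "\<phi> \<in> ring_hom R R'"
    and semilinear: "semilinear R M M' \<phi> \<psi>"
    and extends: "\<lbrakk> r \<in> carrier R; s \<in> carrier R \<rbrakk> \<Longrightarrow> \<psi> (D (r, s)) = D' (\<phi> r, \<phi> s)"

text \<open>
  The submodule \<open>I M\<close>: finite sums of products \<open>i x\<close>, in the style of \<^const>\<open>ideal_prod\<close>.
\<close>

inductive_set ideal_smult :: "('a, 'm, 'd) module_scheme \<Rightarrow> 'a set \<Rightarrow> 'm set"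
  for M :: "('a, 'm, 'd) module_scheme" and I :: "'a set"
  where
    smult: "\<lbrakk> i \<in> I; x \<in> carrier M \<rbrakk> \<Longrightarrow> i \<odot>\<^bsub>M\<^esub> x \<in> ideal_smult M I"
  | add: "\<lbrakk> x \<in> ideal_smult M I; y \<in> ideal_smult M I \<rbrakk> \<Longrightarrow> x \<oplus>\<^bsub>M\<^esub> y \<in> ideal_smult M I"

definition bidifferential_ideal_pair ::
    "('a, 'c) ring_scheme \<Rightarrow> ('a, 'm, 'd) module_scheme \<Rightarrow> ('a \<times> 'a \<Rightarrow> 'm) \<Rightarrow>
     'a set \<Rightarrow> 'a set \<Rightarrow> bool"
  where "bidifferential_ideal_pair R M D I J \<longleftrightarrow>
    ideal I R \<and> ideal J R \<and>
    D ` (I \<times> carrier R) \<subseteq> ideal_smult M I \<and>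
    D ` (carrier R \<times> J) \<subseteq> ideal_smult M J"

locale lifting_extension = biderivation_extension +
  assumes lifting: "bidifferential_ideal_pair R M D I J \<Longrightarrow>
    bidifferential_ideal_pair R' M' D' (Idl\<^bsub>R'\<^esub> (\<phi> ` I)) (Idl\<^bsub>R'\<^esub> (\<phi> ` J))"

section \<open>Localization\<close>

text \<open>
  The carrier \<open>C\<close> with scalar action \<open>act\<close> is either the ring itself, acting by multiplication,
  or a module. Pairs \<open>(x, s)\<close> stand for the fraction \<open>x / s\<close>; the factor \<open>u\<close> is needed in the
  presence of zero divisors and torsion.
\<close>

definition frac_rel :: "('a \<Rightarrow> 'm \<Rightarrow> 'm) \<Rightarrow> 'm set \<Rightarrow> 'a set \<Rightarrow> (('m \<times> 'a) \<times> ('m \<times> 'a)) set"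
  where "frac_rel act C S =
    {((x, s), (y, t)). x \<in> C \<and> y \<in> C \<and> s \<in> S \<and> t \<in> S \<and>
      (\<exists>u\<in>S. act u (act t x) = act u (act s y))}"

definition ring_frac :: "('a, 'c) ring_scheme \<Rightarrow> 'a set \<Rightarrow> 'a \<Rightarrow> 'a \<Rightarrow> ('a \<times> 'a) set"
  where "ring_frac R S r s = frac_rel (mult R) (carrier R) S `` {(r, s)}"

definition module_frac :: "('a, 'm, 'd) module_scheme \<Rightarrow> 'a set \<Rightarrow> 'm \<Rightarrow> 'a \<Rightarrow> ('m \<times> 'a) set"
  where "module_frac M S x s = frac_rel (smult M) (carrier M) S `` {(x, s)}"

text \<open>
  The unions in the operations below range over the representatives of the two fractions;
  each choice gives the same class.
\<close>

definition loc_ring :: "('a, 'c) ring_scheme \<Rightarrow> 'a set \<Rightarrow> ('a \<times> 'a) set ring"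
  where "loc_ring R S =
    \<lparr> carrier = (carrier R \<times> S) // frac_rel (mult R) (carrier R) S,
      mult = (\<lambda>A B. \<Union>(a, s)\<in>A. \<Union>(b, t)\<in>B. ring_frac R S (a \<otimes>\<^bsub>R\<^esub> b) (s \<otimes>\<^bsub>R\<^esub> t)),
      one = ring_frac R S \<one>\<^bsub>R\<^esub> \<one>\<^bsub>R\<^esub>,
      zero = ring_frac R S \<zero>\<^bsub>R\<^esub> \<one>\<^bsub>R\<^esub>,
      add = (\<lambda>A B. \<Union>(a, s)\<in>A. \<Union>(b, t)\<in>B.
        ring_frac R S (t \<otimes>\<^bsub>R\<^esub> a \<oplus>\<^bsub>R\<^esub> s \<otimes>\<^bsub>R\<^esub> b) (s \<otimes>\<^bsub>R\<^esub> t)) \<rparr>"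

text \<open>
  The record type of modules inherits \<open>mult\<close> and \<open>one\<close> from rings; they play no role for
  modules and are left undefined.
\<close>

definition loc_module ::
    "('a, 'c) ring_scheme \<Rightarrow> ('a, 'm, 'd) module_scheme \<Rightarrow> 'a set \<Rightarrow>
     (('a \<times> 'a) set, ('m \<times> 'a) set) module"
  where "loc_module R M S =
    \<lparr> carrier = (carrier M \<times> S) // frac_rel (smult M) (carrier M) S,
      mult = (\<lambda>_ _. undefined),
      one = undefined,
      zero = module_frac M S \<zero>\<^bsub>M\<^esub> \<one>\<^bsub>R\<^esub>,
      add = (\<lambda>A B. \<Union>(x, s)\<in>A. \<Union>(y, t)\<in>B.
        module_frac M S (t \<odot>\<^bsub>M\<^esub> x \<oplus>\<^bsub>M\<^esub> s \<odot>\<^bsub>M\<^esub> y) (s \<otimes>\<^bsub>R\<^esub> t)),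
      smult = (\<lambda>A B. \<Union>(a, s)\<in>A. \<Union>(x, t)\<in>B.
        module_frac M S (a \<odot>\<^bsub>M\<^esub> x) (s \<otimes>\<^bsub>R\<^esub> t)) \<rparr>"

end

theory Submission
  imports Defs
begin

text \<open>
  A derivation \<open>d\<close> along \<open>\<phi> : R \<rightarrow> \<Sigma>\<^sup>-\<^sup>1R\<close> with values in a \<open>\<Sigma>\<^sup>-\<^sup>1R\<close>-module extends uniquely to \<open>\<Sigma>\<^sup>-\<^sup>1R\<close>, by the
  quotient rule \<open>s d(a/s) + (a/s) d(s) = d(a)\<close>. Applied to the second argument and then to the
  first, this yields the unique extension of a biderivation. For the lifting property, the
  elements \<open>X\<close> of the extended ideal \<open>I'\<close> with \<open>{X, \<Sigma>\<^sup>-\<^sup>1R} \<subseteq> I' \<Sigma>\<^sup>-\<^sup>1M\<close> form an ideal, which contains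
  the image of \<open>I\<close> by the quotient rule. The other side follows by swapping the arguments.
\<close>

section \<open>Localization of rings and modules\<close>

text \<open>The ring acting on itself by multiplication. With it the localized ring becomes a
  special case of the localized module, so well-definedness and the additive axioms are proved only
  once.\<close>

definition regular_module :: "('a, 'c) ring_scheme \<Rightarrow> ('a, 'a) module"
  where "regular_module R =
    \<lparr> carrier = carrier R, mult = mult R, one = one R, zero = zero R, add = add R,
      smult = mult R \<rparr>"

lemma regular_module_simps [simp]:
  "carrier (regular_module R) = carrier R"
  "zero (regular_module R) = zero R"
  "add (regular_module R) = add R"
  "smult (regular_module R) = mult R"
  by (simp_all add: regular_module_def)

lemma (in cring) module_regular_module: "module R (regular_module R)"
  by (intro moduleI abelian_groupI is_cring)
    (auto simp: l_distr r_distr m_assoc a_ac intro: bexI[of _ "\<ominus> _"] l_neg)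

lemma ring_frac_eq_module_frac: "ring_frac R S = module_frac (regular_module R) S"
  by (intro ext) (simp add: ring_frac_def module_frac_def)

text \<open>For the regular module the two constructions unfold to the same expressions, with scalar
  action in the role of multiplication. Only the unit has no counterpart on the module side.\<close>

lemma loc_ring_simps:
  "carrier (loc_ring R S) = carrier (loc_module R (regular_module R) S)"
  "zero (loc_ring R S) = zero (loc_module R (regular_module R) S)"
  "add (loc_ring R S) = add (loc_module R (regular_module R) S)"
  "mult (loc_ring R S) = smult (loc_module R (regular_module R) S)"
  "one (loc_ring R S) = ring_frac R S \<one>\<^bsub>R\<^esub> \<one>\<^bsub>R\<^esub>"
  by (simp_all add: loc_ring_def loc_module_def ring_frac_eq_module_frac)

text \<open>Evaluates an operation defined as a union over representatives: all choices give the
  same class, and \<open>p\<close> and \<open>q\<close> witness that the union is not empty.\<close>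

lemma UN_UN_eq_const:
  assumes "p \<in> A" and "q \<in> B"
    and "\<And>a s b t. (a, s) \<in> A \<Longrightarrow> (b, t) \<in> B \<Longrightarrow> f a s b t = C"
  shows "(\<Union>(a, s)\<in>A. \<Union>(b, t)\<in>B. f a s b t) = C"
  using assms by (cases p; cases q) fastforce

lemma (in module) smult_lcomm:
  "\<lbrakk>a \<in> carrier R; b \<in> carrier R; x \<in> carrier M\<rbrakk> \<Longrightarrow>
    a \<odot>\<^bsub>M\<^esub> (b \<odot>\<^bsub>M\<^esub> x) = b \<odot>\<^bsub>M\<^esub> (a \<odot>\<^bsub>M\<^esub> x)"
  by (metis m_comm smult_assoc1)

locale module_localization = module R M
  for R :: "('a, 'c) ring_scheme" and M :: "('a, 'm, 'd) module_scheme" +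
  fixes S :: "'a set"
  assumes submonoid: "submonoid S R"
begin

lemma S_carrier [simp]: "s \<in> S \<Longrightarrow> s \<in> carrier R"
  using submonoid by (auto dest: submonoid.subset)

lemma S_mult [simp]: "s \<in> S \<Longrightarrow> t \<in> S \<Longrightarrow> s \<otimes>\<^bsub>R\<^esub> t \<in> S"
  using submonoid by (rule submonoid.m_closed)

lemma S_one [simp]: "\<one>\<^bsub>R\<^esub> \<in> S"
  using submonoid by (rule submonoid.one_closed)

lemma localization_regular_module: "module_localization R (regular_module R) S"
  by (intro module_localization.intro module_regular_module module_localization_axioms.intro submonoid)

lemmas smult_normal = smult_assoc1 smult_lcomm smult_r_distr

lemma mem_module_frac:
  "(y, t) \<in> module_frac M S x s \<longleftrightarrow> x \<in> carrier M \<and> y \<in> carrier M \<and> s \<in> S \<and> t \<in> S \<and>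
    (\<exists>u\<in>S. u \<odot>\<^bsub>M\<^esub> (t \<odot>\<^bsub>M\<^esub> x) = u \<odot>\<^bsub>M\<^esub> (s \<odot>\<^bsub>M\<^esub> y))"
  by (auto simp: module_frac_def frac_rel_def)

lemma equiv_frac_rel: "equiv (carrier M \<times> S) (frac_rel (smult M) (carrier M) S)"
proof (rule equivI)
  show "frac_rel (smult M) (carrier M) S \<subseteq> (carrier M \<times> S) \<times> carrier M \<times> S"
    by (auto simp: frac_rel_def)
  show "refl_on (carrier M \<times> S) (frac_rel (smult M) (carrier M) S)"
    by (auto simp: refl_on_def frac_rel_def intro: S_one)
  show "sym (frac_rel (smult M) (carrier M) S)"
    by (intro symI) (clarsimp simp: frac_rel_def, metis)
  have "\<exists>w\<in>S. w \<odot>\<^bsub>M\<^esub> (r \<odot>\<^bsub>M\<^esub> x) = w \<odot>\<^bsub>M\<^esub> (s \<odot>\<^bsub>M\<^esub> z)"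
    if [simp]: "x \<in> carrier M" "y \<in> carrier M" "z \<in> carrier M" "s \<in> S" "t \<in> S" "r \<in> S" "u \<in> S" "v \<in> S"
      and u: "u \<odot>\<^bsub>M\<^esub> (t \<odot>\<^bsub>M\<^esub> x) = u \<odot>\<^bsub>M\<^esub> (s \<odot>\<^bsub>M\<^esub> y)"
      and v: "v \<odot>\<^bsub>M\<^esub> (r \<odot>\<^bsub>M\<^esub> y) = v \<odot>\<^bsub>M\<^esub> (t \<odot>\<^bsub>M\<^esub> z)" for x y z s t r u v
  proof
    \<comment> \<open>The witness is the product of both multipliers and the middle denominator
      \<open>t\<close>: up to reordering, \<open>u v t r x = u v r s y = u v t s z\<close>.\<close>
    show "u \<otimes>\<^bsub>R\<^esub> v \<otimes>\<^bsub>R\<^esub> t \<in> S" by simp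
    have "v \<odot>\<^bsub>M\<^esub> (r \<odot>\<^bsub>M\<^esub> (u \<odot>\<^bsub>M\<^esub> (t \<odot>\<^bsub>M\<^esub> x))) = u \<odot>\<^bsub>M\<^esub> (s \<odot>\<^bsub>M\<^esub> (v \<odot>\<^bsub>M\<^esub> (r \<odot>\<^bsub>M\<^esub> y)))"
      unfolding u by (simp add: smult_normal)
    then show "u \<otimes>\<^bsub>R\<^esub> v \<otimes>\<^bsub>R\<^esub> t \<odot>\<^bsub>M\<^esub> (r \<odot>\<^bsub>M\<^esub> x) = u \<otimes>\<^bsub>R\<^esub> v \<otimes>\<^bsub>R\<^esub> t \<odot>\<^bsub>M\<^esub> (s \<odot>\<^bsub>M\<^esub> z)"
      unfolding v by (simp add: smult_normal)
  qed
  then show "trans (frac_rel (smult M) (carrier M) S)"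
    by (intro transI) (clarsimp simp: frac_rel_def)
qed

lemma module_frac_eq_iff:
  assumes "x \<in> carrier M" "y \<in> carrier M" "s \<in> S" "t \<in> S"
  shows "module_frac M S x s = module_frac M S y t \<longleftrightarrow>
    (\<exists>u\<in>S. u \<odot>\<^bsub>M\<^esub> (t \<odot>\<^bsub>M\<^esub> x) = u \<odot>\<^bsub>M\<^esub> (s \<odot>\<^bsub>M\<^esub> y))"
  using assms equiv_class_eq_iff[OF equiv_frac_rel, of "(x, s)" "(y, t)"]
  by (auto simp: module_frac_def frac_rel_def)

lemma module_frac_eqI:
  assumes "x \<in> carrier M" "y \<in> carrier M" "s \<in> S" "t \<in> S" "t \<odot>\<^bsub>M\<^esub> x = s \<odot>\<^bsub>M\<^esub> y"
  shows "module_frac M S x s = module_frac M S y t"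
  using assms module_frac_eq_iff S_one by metis

lemma module_frac_self: "x \<in> carrier M \<Longrightarrow> s \<in> S \<Longrightarrow> (x, s) \<in> module_frac M S x s"
  using S_one by (auto simp: mem_module_frac)

lemma loc_module_carrier:
  "carrier (loc_module R M S) = {module_frac M S x s | x s. x \<in> carrier M \<and> s \<in> S}"
  by (auto simp: loc_module_def module_frac_def quotient_def)

lemma loc_module_zero: "\<zero>\<^bsub>loc_module R M S\<^esub> = module_frac M S \<zero>\<^bsub>M\<^esub> \<one>\<^bsub>R\<^esub>"
  by (simp add: loc_module_def)

text \<open>This is well-definedness of addition. If \<open>u\<close> and \<open>v\<close> witness
  that the two summands have other representatives, then the product of \<open>u\<close> and
  \<open>v\<close> witnesses that the two sums agree.\<close>

lemma loc_module_add:
  assumes [simp]: "x \<in> carrier M" "y \<in> carrier M" "s \<in> S" "t \<in> S"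
  shows "module_frac M S x s \<oplus>\<^bsub>loc_module R M S\<^esub> module_frac M S y t =
    module_frac M S (t \<odot>\<^bsub>M\<^esub> x \<oplus>\<^bsub>M\<^esub> s \<odot>\<^bsub>M\<^esub> y) (s \<otimes>\<^bsub>R\<^esub> t)"
  unfolding loc_module_def partial_object.simps ring.simps
proof (simp, rule UN_UN_eq_const[OF module_frac_self module_frac_self])
  fix x' s' y' t'
  assume "(x', s') \<in> module_frac M S x s" "(y', t') \<in> module_frac M S y t"
  then obtain u v where [simp]: "x' \<in> carrier M" "s' \<in> S" "y' \<in> carrier M" "t' \<in> S" "u \<in> S" "v \<in> S"
    and u: "u \<odot>\<^bsub>M\<^esub> (s' \<odot>\<^bsub>M\<^esub> x) = u \<odot>\<^bsub>M\<^esub> (s \<odot>\<^bsub>M\<^esub> x')"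
    and v: "v \<odot>\<^bsub>M\<^esub> (t' \<odot>\<^bsub>M\<^esub> y) = v \<odot>\<^bsub>M\<^esub> (t \<odot>\<^bsub>M\<^esub> y')"
    by (auto simp: mem_module_frac)
  have "u \<otimes>\<^bsub>R\<^esub> v \<odot>\<^bsub>M\<^esub> (s \<otimes>\<^bsub>R\<^esub> t \<odot>\<^bsub>M\<^esub> (t' \<odot>\<^bsub>M\<^esub> x' \<oplus>\<^bsub>M\<^esub> s' \<odot>\<^bsub>M\<^esub> y')) =
     v \<odot>\<^bsub>M\<^esub> (t \<odot>\<^bsub>M\<^esub> (t' \<odot>\<^bsub>M\<^esub> (u \<odot>\<^bsub>M\<^esub> (s \<odot>\<^bsub>M\<^esub> x')))) \<oplus>\<^bsub>M\<^esub>
     u \<odot>\<^bsub>M\<^esub> (s \<odot>\<^bsub>M\<^esub> (s' \<odot>\<^bsub>M\<^esub> (v \<odot>\<^bsub>M\<^esub> (t \<odot>\<^bsub>M\<^esub> y'))))"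
    by (simp add: smult_normal)
  also have "\<dots> = u \<otimes>\<^bsub>R\<^esub> v \<odot>\<^bsub>M\<^esub> (s' \<otimes>\<^bsub>R\<^esub> t' \<odot>\<^bsub>M\<^esub> (t \<odot>\<^bsub>M\<^esub> x \<oplus>\<^bsub>M\<^esub> s \<odot>\<^bsub>M\<^esub> y))"
    unfolding u[symmetric] v[symmetric] by (simp add: smult_normal)
  finally show "module_frac M S (t' \<odot>\<^bsub>M\<^esub> x' \<oplus>\<^bsub>M\<^esub> s' \<odot>\<^bsub>M\<^esub> y') (s' \<otimes>\<^bsub>R\<^esub> t') =
      module_frac M S (t \<odot>\<^bsub>M\<^esub> x \<oplus>\<^bsub>M\<^esub> s \<odot>\<^bsub>M\<^esub> y) (s \<otimes>\<^bsub>R\<^esub> t)"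
    by (subst module_frac_eq_iff) (auto intro!: bexI[of _ "u \<otimes>\<^bsub>R\<^esub> v"])
qed simp_all

text \<open>Well-definedness again comes from the product of the two multipliers, where the scalar
  is read as a fraction of the regular module.\<close>

lemma loc_module_smult:
  assumes [simp]: "a \<in> carrier R" "x \<in> carrier M" "s \<in> S" "t \<in> S"
  shows "ring_frac R S a s \<odot>\<^bsub>loc_module R M S\<^esub> module_frac M S x t =
    module_frac M S (a \<odot>\<^bsub>M\<^esub> x) (s \<otimes>\<^bsub>R\<^esub> t)"
proof -
  interpret reg: module_localization R "regular_module R" S
    by (rule localization_regular_module)
  show ?thesis
    unfolding loc_module_def module.simps
  proof (rule UN_UN_eq_const)
    show "(a, s) \<in> ring_frac R S a s"
      by (simp add: reg.module_frac_self ring_frac_eq_module_frac)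
    show "(x, t) \<in> module_frac M S x t"
      by (simp add: module_frac_self)
    fix a' s' x' t'
    assume a': "(a', s') \<in> ring_frac R S a s" and x': "(x', t') \<in> module_frac M S x t"
    from a' x' obtain u v where [simp]: "a' \<in> carrier R" "s' \<in> S" "x' \<in> carrier M" "t' \<in> S" "u \<in> S" "v \<in> S"
      and u: "u \<otimes>\<^bsub>R\<^esub> (s' \<otimes>\<^bsub>R\<^esub> a) = u \<otimes>\<^bsub>R\<^esub> (s \<otimes>\<^bsub>R\<^esub> a')"
      and v: "v \<odot>\<^bsub>M\<^esub> (t' \<odot>\<^bsub>M\<^esub> x) = v \<odot>\<^bsub>M\<^esub> (t \<odot>\<^bsub>M\<^esub> x')"
      by (auto simp: mem_module_frac ring_frac_eq_module_frac reg.mem_module_frac)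
    have "u \<otimes>\<^bsub>R\<^esub> v \<odot>\<^bsub>M\<^esub> (s \<otimes>\<^bsub>R\<^esub> t \<odot>\<^bsub>M\<^esub> (a' \<odot>\<^bsub>M\<^esub> x')) =
       (u \<otimes>\<^bsub>R\<^esub> (s \<otimes>\<^bsub>R\<^esub> a')) \<odot>\<^bsub>M\<^esub> (v \<odot>\<^bsub>M\<^esub> (t \<odot>\<^bsub>M\<^esub> x'))"
      by (simp add: smult_normal)
    also have "\<dots> = u \<otimes>\<^bsub>R\<^esub> v \<odot>\<^bsub>M\<^esub> (s' \<otimes>\<^bsub>R\<^esub> t' \<odot>\<^bsub>M\<^esub> (a \<odot>\<^bsub>M\<^esub> x))"
      unfolding u[symmetric] v[symmetric] by (simp add: smult_normal)
    finally show "module_frac M S (a' \<odot>\<^bsub>M\<^esub> x') (s' \<otimes>\<^bsub>R\<^esub> t') =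
        module_frac M S (a \<odot>\<^bsub>M\<^esub> x) (s \<otimes>\<^bsub>R\<^esub> t)"
      by (subst module_frac_eq_iff) (auto intro!: bexI[of _ "u \<otimes>\<^bsub>R\<^esub> v"])
  qed
qed

section \<open>Group, ring and module structure of the localizations\<close>

lemma abelian_group_loc_module: "abelian_group (loc_module R M S)"
proof (rule abelian_groupI, goal_cases)
  case (1 X Y)
  then show ?case by (fastforce simp: loc_module_carrier loc_module_add)
next
  case 2
  then show ?case by (auto simp: loc_module_carrier loc_module_zero intro: S_one)
next
  case (3 X Y Z)
  then show ?case
    by (auto simp: loc_module_carrier loc_module_add smult_normal M.a_ac m_ac)
next
  case (4 X Y)
  then show ?case
    by (auto simp: loc_module_carrier loc_module_add smult_normal M.a_ac m_ac)
next
  case (5 X)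
  then show ?case
    by (auto simp: loc_module_carrier loc_module_add loc_module_zero)
next
  case (6 X)
  then obtain x s where [simp]: "x \<in> carrier M" "s \<in> S" and X: "X = module_frac M S x s"
    by (auto simp: loc_module_carrier)
  \<comment> \<open>The sum has numerator zero over the denominator \<open>s\<close> times
    \<open>s\<close>, whereas the zero element is zero over one, so the two are compared by
    cross-multiplication.\<close>
  have "module_frac M S (\<ominus>\<^bsub>M\<^esub> x) s \<oplus>\<^bsub>loc_module R M S\<^esub> X = \<zero>\<^bsub>loc_module R M S\<^esub>"
    unfolding X loc_module_zero
    by (subst loc_module_add)
      (auto intro!: module_frac_eqI simp: smult_r_minus M.l_neg del: equalityI)
  moreover have "module_frac M S (\<ominus>\<^bsub>M\<^esub> x) s \<in> carrier (loc_module R M S)"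
    unfolding loc_module_carrier by (blast intro: M.a_inv_closed \<open>x \<in> carrier M\<close> \<open>s \<in> S\<close>)
  ultimately show ?case by blast
qed

lemma loc_ring_carrier:
  "carrier (loc_ring R S) = {ring_frac R S a s | a s. a \<in> carrier R \<and> s \<in> S}"
  using module_localization.loc_module_carrier[OF localization_regular_module]
  by (simp add: loc_ring_simps ring_frac_eq_module_frac)

lemma loc_ring_add:
  assumes "a \<in> carrier R" "b \<in> carrier R" "s \<in> S" "t \<in> S"
  shows "ring_frac R S a s \<oplus>\<^bsub>loc_ring R S\<^esub> ring_frac R S b t =
    ring_frac R S (t \<otimes>\<^bsub>R\<^esub> a \<oplus>\<^bsub>R\<^esub> s \<otimes>\<^bsub>R\<^esub> b) (s \<otimes>\<^bsub>R\<^esub> t)"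
  using module_localization.loc_module_add[OF localization_regular_module] assms
  by (simp add: loc_ring_simps ring_frac_eq_module_frac)

lemma loc_ring_mult:
  assumes "a \<in> carrier R" "b \<in> carrier R" "s \<in> S" "t \<in> S"
  shows "ring_frac R S a s \<otimes>\<^bsub>loc_ring R S\<^esub> ring_frac R S b t =
    ring_frac R S (a \<otimes>\<^bsub>R\<^esub> b) (s \<otimes>\<^bsub>R\<^esub> t)"
  using module_localization.loc_module_smult[OF localization_regular_module] assms
  by (simp add: loc_ring_simps ring_frac_eq_module_frac)

lemma ring_frac_eq_iff:
  assumes "a \<in> carrier R" "b \<in> carrier R" "s \<in> S" "t \<in> S"
  shows "ring_frac R S a s = ring_frac R S b t \<longleftrightarrow>
    (\<exists>u\<in>S. u \<otimes>\<^bsub>R\<^esub> (t \<otimes>\<^bsub>R\<^esub> a) = u \<otimes>\<^bsub>R\<^esub> (s \<otimes>\<^bsub>R\<^esub> b))"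
  using module_localization.module_frac_eq_iff[OF localization_regular_module] assms
  by (simp add: ring_frac_eq_module_frac)

lemma ring_frac_eqI:
  assumes "a \<in> carrier R" "b \<in> carrier R" "s \<in> S" "t \<in> S" "t \<otimes>\<^bsub>R\<^esub> a = s \<otimes>\<^bsub>R\<^esub> b"
  shows "ring_frac R S a s = ring_frac R S b t"
  using assms ring_frac_eq_iff S_one by metis

lemma cring_loc_ring: "cring (loc_ring R S)"
proof (rule cringI)
  \<comment> \<open>Carrier, zero and addition of the localized ring are those of the localized
    regular module, so the additive group is inherited.\<close>
  have "abelian_group (loc_module R (regular_module R) S)"
    by (rule module_localization.abelian_group_loc_module[OF localization_regular_module])
  then show "abelian_group (loc_ring R S)"
    by (intro abelian_groupI; unfold loc_ring_simps; elim abelian_groupE)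
  show "Group.comm_monoid (loc_ring R S)"
  proof (rule comm_monoidI, goal_cases)
    case (1 X Y)
    then show ?case by (fastforce simp: loc_ring_carrier loc_ring_mult)
  next
    case 2
    then show ?case by (auto simp: loc_ring_carrier loc_ring_simps(5) intro: S_one)
  qed (auto simp: loc_ring_carrier loc_ring_mult m_ac loc_ring_simps(5))
  show "(X \<oplus>\<^bsub>loc_ring R S\<^esub> Y) \<otimes>\<^bsub>loc_ring R S\<^esub> Z =
      X \<otimes>\<^bsub>loc_ring R S\<^esub> Z \<oplus>\<^bsub>loc_ring R S\<^esub> Y \<otimes>\<^bsub>loc_ring R S\<^esub> Z"
    if XYZ: "X \<in> carrier (loc_ring R S)" "Y \<in> carrier (loc_ring R S)" "Z \<in> carrier (loc_ring R S)"
    for X Y Z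
    \<comment> \<open>The right-hand side carries the denominator of \<open>Z\<close> once more than
      the left-hand side, hence \<open>ring_frac_eqI\<close> instead of plain rewriting.\<close>
    using XYZ by (auto simp: loc_ring_carrier loc_ring_mult loc_ring_add l_distr r_distr m_ac
        intro!: ring_frac_eqI del: equalityI)
qed

text \<open>Only the two distributive laws, cases 2 and 3, compare fractions with different
  denominators and need cross-multiplication; in the other equations the fractions agree literally
  after normalization.\<close>

lemma module_loc_module: "module (loc_ring R S) (loc_module R M S)"
proof (rule moduleI[OF cring_loc_ring abelian_group_loc_module], goal_cases)
  case (1 A X)
  then show ?case by (fastforce simp: loc_ring_carrier loc_module_carrier loc_module_smult)
next
  case (2 A B X)
  then show ?case
    by (auto simp: loc_ring_carrier loc_module_carrier loc_module_smult loc_ring_add loc_module_add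
        smult_l_distr smult_normal m_ac intro!: module_frac_eqI del: equalityI)
next
  case (3 A X Y)
  then show ?case
    by (auto simp: loc_ring_carrier loc_module_carrier loc_module_smult loc_ring_add loc_module_add
        smult_normal m_ac intro!: module_frac_eqI del: equalityI)
next
  case (4 A B X)
  then show ?case
    by (auto simp: loc_ring_carrier loc_module_carrier loc_module_smult loc_ring_mult
        smult_normal m_ac)
next
  case (5 X)
  then show ?case
    by (auto simp: loc_ring_simps(5) loc_module_carrier loc_module_smult)
qed

lemma ring_hom_ring_frac: "(\<lambda>r. ring_frac R S r \<one>\<^bsub>R\<^esub>) \<in> ring_hom R (loc_ring R S)"
  by (rule ring_hom_memI)
    (auto simp: loc_ring_carrier loc_ring_mult loc_ring_add loc_ring_simps(5) intro: S_one)

lemma semilinear_module_frac: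
  "semilinear R M (loc_module R M S) (\<lambda>r. ring_frac R S r \<one>\<^bsub>R\<^esub>) (\<lambda>x. module_frac M S x \<one>\<^bsub>R\<^esub>)"
  unfolding semilinear_def
  by (auto simp: loc_module_carrier loc_module_add loc_module_smult intro: S_one)

text \<open>The inverse of \<open>s / 1\<close> is \<open>1 / s\<close>.\<close>

lemma Units_ring_frac:
  assumes [simp]: "s \<in> S"
  shows "ring_frac R S s \<one>\<^bsub>R\<^esub> \<in> Units (loc_ring R S)"
proof -
  interpret L: cring "loc_ring R S" by (rule cring_loc_ring)
  have "ring_frac R S s \<one>\<^bsub>R\<^esub> \<otimes>\<^bsub>loc_ring R S\<^esub> ring_frac R S \<one>\<^bsub>R\<^esub> s = \<one>\<^bsub>loc_ring R S\<^esub>"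
    by (simp add: loc_ring_mult loc_ring_simps(5) ring_frac_eqI)
  moreover have "ring_frac R S s \<one>\<^bsub>R\<^esub> \<in> carrier (loc_ring R S)"
    and "ring_frac R S \<one>\<^bsub>R\<^esub> s \<in> carrier (loc_ring R S)"
    unfolding loc_ring_carrier by (blast intro: S_one S_carrier assms one_closed)+
  ultimately show ?thesis
    using L.m_comm unfolding Units_def by fastforce
qed

end

section \<open>Extension of derivations\<close>

text \<open>A derivation into \<open>N\<close> regarded as an \<open>R\<close>-module by restriction
  of scalars along \<open>\<phi>\<close>. Stating it this way avoids constructing the restricted
  module.\<close>

definition derivation_along ::
    "('a, 'c) ring_scheme \<Rightarrow> ('b, 'n, 'e) module_scheme \<Rightarrow> ('a \<Rightarrow> 'b) \<Rightarrow> ('a \<Rightarrow> 'n) \<Rightarrow> bool"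
  where "derivation_along R N \<phi> d \<longleftrightarrow>
    d \<in> carrier R \<rightarrow> carrier N \<and>
    (\<forall>x\<in>carrier R. \<forall>y\<in>carrier R. d (x \<oplus>\<^bsub>R\<^esub> y) = d x \<oplus>\<^bsub>N\<^esub> d y) \<and>
    (\<forall>x\<in>carrier R. \<forall>y\<in>carrier R. d (x \<otimes>\<^bsub>R\<^esub> y) = \<phi> x \<odot>\<^bsub>N\<^esub> d y \<oplus>\<^bsub>N\<^esub> \<phi> y \<odot>\<^bsub>N\<^esub> d x)"

lemma
  assumes "derivation_along R N \<phi> d"
  shows derivation_along_closed: "x \<in> carrier R \<Longrightarrow> d x \<in> carrier N"
    and derivation_along_add: "x \<in> carrier R \<Longrightarrow> y \<in> carrier R \<Longrightarrow> d (x \<oplus>\<^bsub>R\<^esub> y) = d x \<oplus>\<^bsub>N\<^esub> d y"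
    and derivation_along_mult: "x \<in> carrier R \<Longrightarrow> y \<in> carrier R \<Longrightarrow>
      d (x \<otimes>\<^bsub>R\<^esub> y) = \<phi> x \<odot>\<^bsub>N\<^esub> d y \<oplus>\<^bsub>N\<^esub> \<phi> y \<odot>\<^bsub>N\<^esub> d x"
  using assms by (auto simp: derivation_along_def)

lemma
  assumes "derivation R N d"
  shows derivation_closed: "x \<in> carrier R \<Longrightarrow> d x \<in> carrier N"
    and derivation_add: "x \<in> carrier R \<Longrightarrow> y \<in> carrier R \<Longrightarrow> d (x \<oplus>\<^bsub>R\<^esub> y) = d x \<oplus>\<^bsub>N\<^esub> d y"
    and derivation_mult: "x \<in> carrier R \<Longrightarrow> y \<in> carrier R \<Longrightarrow>
      d (x \<otimes>\<^bsub>R\<^esub> y) = x \<odot>\<^bsub>N\<^esub> d y \<oplus>\<^bsub>N\<^esub> y \<odot>\<^bsub>N\<^esub> d x"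
  using assms by (auto simp: derivation_def)

lemma (in ring) derivation_cong:
  assumes "derivation R M d" and "\<And>x. x \<in> carrier R \<Longrightarrow> e x = d x"
  shows "derivation R M e"
  using assms by (auto simp: derivation_def)

text \<open>Scalars commute with each other, so derivations form a module. This serves to compare
  derivations that agree on the image of \<open>\<phi>\<close>, and to recognize
  \<open>{A, -}\<close> as a derivation.\<close>

lemma (in module) derivation_lincomb:
  assumes d: "derivation R M d" and e: "derivation R M e"
    and [simp]: "a \<in> carrier R" "b \<in> carrier R"
  shows "derivation R M (\<lambda>x. a \<odot>\<^bsub>M\<^esub> d x \<oplus>\<^bsub>M\<^esub> b \<odot>\<^bsub>M\<^esub> e x)"
proof -
  note [simp] = derivation_closed[OF d] derivation_closed[OF e]
  show ?thesis
    unfolding derivation_def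
    by (auto simp: derivation_add[OF d] derivation_add[OF e] derivation_mult[OF d]
        derivation_mult[OF e] smult_r_distr smult_lcomm M.a_ac)
qed

text \<open>The localization described by its properties: elements of \<open>S\<close> become units,
  every element is a fraction, and two elements of \<open>R\<close> have the same image only if some
  element of \<open>S\<close> equalizes them. The extension arguments use these properties and no
  equivalence classes.\<close>

locale ring_localization = base: cring R + loc: cring R'
  for R :: "('a, 'c) ring_scheme" and R' :: "('b, 'e) ring_scheme" +
  fixes S :: "'a set" and \<phi> :: "'a \<Rightarrow> 'b"
  assumes S_subset: "S \<subseteq> carrier R"
    and one_in_S: "\<one>\<^bsub>R\<^esub> \<in> S"
    and S_m_closed: "s \<in> S \<Longrightarrow> t \<in> S \<Longrightarrow> s \<otimes>\<^bsub>R\<^esub> t \<in> S"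
    and hom: "\<phi> \<in> ring_hom R R'"
    and Units_image: "s \<in> S \<Longrightarrow> \<phi> s \<in> Units R'"
    and fraction: "A \<in> carrier R' \<Longrightarrow> \<exists>a\<in>carrier R. \<exists>s\<in>S. \<phi> s \<otimes>\<^bsub>R'\<^esub> A = \<phi> a"
    and image_eqD: "a \<in> carrier R \<Longrightarrow> b \<in> carrier R \<Longrightarrow> \<phi> a = \<phi> b \<Longrightarrow>
      \<exists>u\<in>S. u \<otimes>\<^bsub>R\<^esub> a = u \<otimes>\<^bsub>R\<^esub> b"
begin

lemma S_carrier [simp]: "s \<in> S \<Longrightarrow> s \<in> carrier R"
  using S_subset by auto

lemmas [simp] = one_in_S S_m_closed ring_hom_closed[OF hom] ring_hom_add[OF hom]
  ring_hom_mult[OF hom] ring_hom_one[OF hom]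

lemma common_denominator:
  assumes A: "A \<in> carrier R'" and B: "B \<in> carrier R'"
  obtains a b s where "a \<in> carrier R" "b \<in> carrier R" "s \<in> S"
    "\<phi> s \<otimes>\<^bsub>R'\<^esub> A = \<phi> a" "\<phi> s \<otimes>\<^bsub>R'\<^esub> B = \<phi> b"
proof -
  obtain a s b t where [simp]: "a \<in> carrier R" "s \<in> S" "b \<in> carrier R" "t \<in> S"
    and a: "\<phi> s \<otimes>\<^bsub>R'\<^esub> A = \<phi> a" and b: "\<phi> t \<otimes>\<^bsub>R'\<^esub> B = \<phi> b"
    using fraction[OF A] fraction[OF B] by blast
  show ?thesis
    by (rule that[of "t \<otimes>\<^bsub>R\<^esub> a" "s \<otimes>\<^bsub>R\<^esub> b" "s \<otimes>\<^bsub>R\<^esub> t"])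
      (simp_all add: A B loc.m_ac flip: a b)
qed

end

locale module_over_localization = ring_localization R R' S \<phi> + module R' N
  for R :: "('a, 'c) ring_scheme" and R' :: "('b, 'e) ring_scheme" and S \<phi>
    and N :: "('b, 'n, 'f) module_scheme"
begin

lemma smult_image_cancel:
  assumes [simp]: "s \<in> S" "x \<in> carrier N" "y \<in> carrier N"
    and eq: "\<phi> s \<odot>\<^bsub>N\<^esub> x = \<phi> s \<odot>\<^bsub>N\<^esub> y"
  shows "x = y"
proof -
  have u: "\<phi> s \<in> Units R'" by (simp add: Units_image)
  have inv: "inv\<^bsub>R'\<^esub> (\<phi> s) \<odot>\<^bsub>N\<^esub> (\<phi> s \<odot>\<^bsub>N\<^esub> w) = w" if [simp]: "w \<in> carrier N" for w
    using u smult_assoc1[of "inv\<^bsub>R'\<^esub> (\<phi> s)" "\<phi> s" w, symmetric] by simp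
  show ?thesis
    using arg_cong[OF eq, of "smult N (inv\<^bsub>R'\<^esub> (\<phi> s))"] by (simp only: inv assms(2,3))
qed

text \<open>Since \<open>\<phi> s\<close> is a unit, the equation can be solved for
  \<open>z\<close>. With \<open>A d(s)\<close> for \<open>x\<close> and \<open>d(a)\<close> for
  \<open>y\<close>, the solution is the value that the quotient rule prescribes at
  \<open>a / s\<close>.\<close>

lemma ex_quotient_rule:
  assumes [simp]: "s \<in> S" "x \<in> carrier N" "y \<in> carrier N"
  shows "\<exists>z\<in>carrier N. \<phi> s \<odot>\<^bsub>N\<^esub> z \<oplus>\<^bsub>N\<^esub> x = y"
proof
  have u [simp]: "\<phi> s \<in> Units R'" by (simp add: Units_image)
  have "\<phi> s \<odot>\<^bsub>N\<^esub> (inv\<^bsub>R'\<^esub> (\<phi> s) \<odot>\<^bsub>N\<^esub> (y \<ominus>\<^bsub>N\<^esub> x)) = y \<ominus>\<^bsub>N\<^esub> x"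
    using u smult_assoc1[of "\<phi> s" "inv\<^bsub>R'\<^esub> (\<phi> s)" "y \<ominus>\<^bsub>N\<^esub> x", symmetric] by simp
  then show "\<phi> s \<odot>\<^bsub>N\<^esub> (inv\<^bsub>R'\<^esub> (\<phi> s) \<odot>\<^bsub>N\<^esub> (y \<ominus>\<^bsub>N\<^esub> x)) \<oplus>\<^bsub>N\<^esub> x = y"
    by (simp add: M.minus_eq M.a_assoc M.l_neg)
qed (simp add: Units_image)

text \<open>The prescribed value does not depend on the fraction representing \<open>A\<close>. Some
  \<open>u\<close> in \<open>S\<close> equalizes the cross products \<open>t a\<close> and
  \<open>s b\<close>, and as \<open>\<phi> u\<close> is a unit, \<open>d\<close> agrees on them; the
  Leibniz rule then turns one equation into the other.\<close>

lemma quotient_rule_independent: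
  assumes d: "derivation_along R N \<phi> d"
    and [simp]: "A \<in> carrier R'" "z \<in> carrier N" "a \<in> carrier R" "b \<in> carrier R" "s \<in> S" "t \<in> S"
    and a: "\<phi> s \<otimes>\<^bsub>R'\<^esub> A = \<phi> a" and b: "\<phi> t \<otimes>\<^bsub>R'\<^esub> A = \<phi> b"
    and z: "\<phi> s \<odot>\<^bsub>N\<^esub> z \<oplus>\<^bsub>N\<^esub> A \<odot>\<^bsub>N\<^esub> d s = d a"
  shows "\<phi> t \<odot>\<^bsub>N\<^esub> z \<oplus>\<^bsub>N\<^esub> A \<odot>\<^bsub>N\<^esub> d t = d b"
proof -
  note [simp] = derivation_along_closed[OF d] and dmult = derivation_along_mult[OF d]
  have eq: "\<phi> (t \<otimes>\<^bsub>R\<^esub> a) = \<phi> (s \<otimes>\<^bsub>R\<^esub> b)"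
    by (simp add: loc.m_lcomm flip: a b)
  then obtain u where [simp]: "u \<in> S" and u: "u \<otimes>\<^bsub>R\<^esub> (t \<otimes>\<^bsub>R\<^esub> a) = u \<otimes>\<^bsub>R\<^esub> (s \<otimes>\<^bsub>R\<^esub> b)"
    using image_eqD[OF _ _ eq] by auto
  \<comment> \<open>Both sides are \<open>d\<close> of the same element, expanded by the Leibniz
    rule. The terms with \<open>d u\<close> coincide because the cross products have the same
    image.\<close>
  have "\<phi> u \<odot>\<^bsub>N\<^esub> d (t \<otimes>\<^bsub>R\<^esub> a) \<oplus>\<^bsub>N\<^esub> \<phi> (s \<otimes>\<^bsub>R\<^esub> b) \<odot>\<^bsub>N\<^esub> d u =
      \<phi> u \<odot>\<^bsub>N\<^esub> d (s \<otimes>\<^bsub>R\<^esub> b) \<oplus>\<^bsub>N\<^esub> \<phi> (s \<otimes>\<^bsub>R\<^esub> b) \<odot>\<^bsub>N\<^esub> d u"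
    using arg_cong[OF u, of d] eq dmult[of u "t \<otimes>\<^bsub>R\<^esub> a"] dmult[of u "s \<otimes>\<^bsub>R\<^esub> b"] by simp
  then have "d (t \<otimes>\<^bsub>R\<^esub> a) = d (s \<otimes>\<^bsub>R\<^esub> b)"
    by - (rule smult_image_cancel[of u], simp_all)
  then have "\<phi> t \<odot>\<^bsub>N\<^esub> d a \<oplus>\<^bsub>N\<^esub> \<phi> a \<odot>\<^bsub>N\<^esub> d t = \<phi> s \<odot>\<^bsub>N\<^esub> d b \<oplus>\<^bsub>N\<^esub> \<phi> b \<odot>\<^bsub>N\<^esub> d s"
    by (simp add: dmult)
  \<comment> \<open>Substituting \<open>z\<close> makes \<open>\<phi> b\<close> times
    \<open>d s\<close> a summand of both sides; cancelling it and then the unit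
    \<open>\<phi> s\<close> leaves the claim.\<close>
  then have "\<phi> s \<odot>\<^bsub>N\<^esub> (\<phi> t \<odot>\<^bsub>N\<^esub> z \<oplus>\<^bsub>N\<^esub> A \<odot>\<^bsub>N\<^esub> d t) \<oplus>\<^bsub>N\<^esub> \<phi> b \<odot>\<^bsub>N\<^esub> d s =
      \<phi> s \<odot>\<^bsub>N\<^esub> d b \<oplus>\<^bsub>N\<^esub> \<phi> b \<odot>\<^bsub>N\<^esub> d s"
    unfolding z[symmetric] a[symmetric] b[symmetric]
    by (simp add: smult_r_distr smult_assoc1 smult_lcomm M.a_ac)
  then show ?thesis
    by - (rule smult_image_cancel[of s], simp_all)
qed

text \<open>
  The equation determining \<open>z = ext_derivation d A\<close> is the quotient rule for \<open>A = a / s\<close>,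
  cleared of denominators.
\<close>

definition ext_derivation :: "('a \<Rightarrow> 'n) \<Rightarrow> 'b \<Rightarrow> 'n"
  where "ext_derivation d A = (SOME z. z \<in> carrier N \<and> (\<exists>a\<in>carrier R. \<exists>s\<in>S.
    \<phi> s \<otimes>\<^bsub>R'\<^esub> A = \<phi> a \<and> \<phi> s \<odot>\<^bsub>N\<^esub> z \<oplus>\<^bsub>N\<^esub> A \<odot>\<^bsub>N\<^esub> d s = d a))"

text \<open>The choice is legitimate because the quotient rule is solvable for one representation of
  \<open>A\<close>; by independence the chosen value then satisfies it for every
  representation.\<close>

lemma
  assumes d: "derivation_along R N \<phi> d" and A: "A \<in> carrier R'"
  shows ext_derivation_closed: "ext_derivation d A \<in> carrier N"
    and ext_derivation_eq: "\<lbrakk>a \<in> carrier R; s \<in> S; \<phi> s \<otimes>\<^bsub>R'\<^esub> A = \<phi> a\<rbrakk> \<Longrightarrow>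
      \<phi> s \<odot>\<^bsub>N\<^esub> ext_derivation d A \<oplus>\<^bsub>N\<^esub> A \<odot>\<^bsub>N\<^esub> d s = d a"
proof -
  let ?P = "\<lambda>z. z \<in> carrier N \<and> (\<exists>a\<in>carrier R. \<exists>s\<in>S.
    \<phi> s \<otimes>\<^bsub>R'\<^esub> A = \<phi> a \<and> \<phi> s \<odot>\<^bsub>N\<^esub> z \<oplus>\<^bsub>N\<^esub> A \<odot>\<^bsub>N\<^esub> d s = d a)"
  obtain a s where as: "a \<in> carrier R" "s \<in> S" "\<phi> s \<otimes>\<^bsub>R'\<^esub> A = \<phi> a"
    using fraction[OF A] by blast
  obtain z where "z \<in> carrier N" "\<phi> s \<odot>\<^bsub>N\<^esub> z \<oplus>\<^bsub>N\<^esub> A \<odot>\<^bsub>N\<^esub> d s = d a"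
    using ex_quotient_rule[of s "A \<odot>\<^bsub>N\<^esub> d s" "d a"] as A derivation_along_closed[OF d] by auto
  with as have "?P z" by blast
  then have P: "?P (ext_derivation d A)"
    unfolding ext_derivation_def by (rule someI)
  then show "ext_derivation d A \<in> carrier N" by simp
  show "\<phi> s \<odot>\<^bsub>N\<^esub> ext_derivation d A \<oplus>\<^bsub>N\<^esub> A \<odot>\<^bsub>N\<^esub> d s = d a"
    if "a \<in> carrier R" "s \<in> S" "\<phi> s \<otimes>\<^bsub>R'\<^esub> A = \<phi> a" for a s
    using P quotient_rule_independent[OF d A] that by blast
qed

text \<open>Since \<open>\<phi> s\<close> can be cancelled, the quotient rule has only one solution,
  so one representation of \<open>A\<close> suffices to identify the value.\<close>

lemma ext_derivation_eqI:
  assumes d: "derivation_along R N \<phi> d"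
    and [simp]: "A \<in> carrier R'" "a \<in> carrier R" "s \<in> S" "z \<in> carrier N"
    and as: "\<phi> s \<otimes>\<^bsub>R'\<^esub> A = \<phi> a" and z: "\<phi> s \<odot>\<^bsub>N\<^esub> z \<oplus>\<^bsub>N\<^esub> A \<odot>\<^bsub>N\<^esub> d s = d a"
  shows "ext_derivation d A = z"
proof (rule smult_image_cancel)
  note [simp] = derivation_along_closed[OF d] ext_derivation_closed[OF d]
  have "\<phi> s \<odot>\<^bsub>N\<^esub> ext_derivation d A \<oplus>\<^bsub>N\<^esub> A \<odot>\<^bsub>N\<^esub> d s = \<phi> s \<odot>\<^bsub>N\<^esub> z \<oplus>\<^bsub>N\<^esub> A \<odot>\<^bsub>N\<^esub> d s"
    using ext_derivation_eq[OF d _ _ _ as] z by simp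
  then show "\<phi> s \<odot>\<^bsub>N\<^esub> ext_derivation d A = \<phi> s \<odot>\<^bsub>N\<^esub> z" by simp
qed (simp_all add: ext_derivation_closed[OF d])

lemma derivation_along_one:
  assumes d: "derivation_along R N \<phi> d"
  shows "d \<one>\<^bsub>R\<^esub> = \<zero>\<^bsub>N\<^esub>"
  using derivation_along_mult[OF d, of "\<one>\<^bsub>R\<^esub>" "\<one>\<^bsub>R\<^esub>"] derivation_along_closed[OF d, of "\<one>\<^bsub>R\<^esub>"]
  by simp

lemma ext_derivation_image:
  assumes d: "derivation_along R N \<phi> d" and [simp]: "r \<in> carrier R"
  shows "ext_derivation d (\<phi> r) = d r"
  \<comment> \<open>The representation is \<open>r / 1\<close>, and the extra term vanishes because
    \<open>d\<close> kills one.\<close>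
  by (rule ext_derivation_eqI[OF d, of _ r "\<one>\<^bsub>R\<^esub>"])
    (simp_all add: derivation_along_closed[OF d] derivation_along_one[OF d])

text \<open>Over a common denominator \<open>s\<close>, the sum is represented by
  \<open>a + b\<close> over \<open>s\<close> and the product by \<open>a b\<close> over
  \<open>s\<close> times \<open>s\<close>. In both cases the expected value satisfies the quotient
  rule.\<close>

lemma derivation_ext_derivation:
  assumes d: "derivation_along R N \<phi> d"
  shows "derivation R' N (ext_derivation d)"
proof -
  note [simp] = derivation_along_closed[OF d] ext_derivation_closed[OF d]
  have "ext_derivation d (A \<oplus>\<^bsub>R'\<^esub> B) = ext_derivation d A \<oplus>\<^bsub>N\<^esub> ext_derivation d B \<and>
      ext_derivation d (A \<otimes>\<^bsub>R'\<^esub> B) = A \<odot>\<^bsub>N\<^esub> ext_derivation d B \<oplus>\<^bsub>N\<^esub> B \<odot>\<^bsub>N\<^esub> ext_derivation d A"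
    if AB [simp]: "A \<in> carrier R'" "B \<in> carrier R'" for A B
  proof -
    obtain a b s where abs [simp]: "a \<in> carrier R" "b \<in> carrier R" "s \<in> S"
      and a: "\<phi> s \<otimes>\<^bsub>R'\<^esub> A = \<phi> a" and b: "\<phi> s \<otimes>\<^bsub>R'\<^esub> B = \<phi> b"
      using AB by (rule common_denominator)
    note da = ext_derivation_eq[OF d AB(1) abs(1,3) a, symmetric]
      and db = ext_derivation_eq[OF d AB(2) abs(2,3) b, symmetric]
    have "ext_derivation d (A \<oplus>\<^bsub>R'\<^esub> B) = ext_derivation d A \<oplus>\<^bsub>N\<^esub> ext_derivation d B"
      by (rule ext_derivation_eqI[OF d, of _ "a \<oplus>\<^bsub>R\<^esub> b" s])
        (simp_all add: derivation_along_add[OF d] da db loc.r_distr a b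
          smult_l_distr smult_r_distr M.a_ac)
    moreover have "ext_derivation d (A \<otimes>\<^bsub>R'\<^esub> B) =
        A \<odot>\<^bsub>N\<^esub> ext_derivation d B \<oplus>\<^bsub>N\<^esub> B \<odot>\<^bsub>N\<^esub> ext_derivation d A"
      by (rule ext_derivation_eqI[OF d, of _ "a \<otimes>\<^bsub>R\<^esub> b" "s \<otimes>\<^bsub>R\<^esub> s"])
        (simp_all add: derivation_along_mult[OF d] da db a[symmetric] b[symmetric] loc.m_ac
          smult_r_distr smult_assoc1 smult_lcomm M.a_ac)
    ultimately show ?thesis by blast
  qed
  then show ?thesis by (auto simp: derivation_def)
qed

text \<open>The Leibniz rule of \<open>e\<close> applied to \<open>\<phi> s\<close> times
  \<open>A\<close> is exactly the quotient rule that determines the extension.\<close>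

lemma ext_derivation_unique:
  assumes d: "derivation_along R N \<phi> d" and e: "derivation R' N e"
    and ed: "\<And>r. r \<in> carrier R \<Longrightarrow> e (\<phi> r) = d r" and A [simp]: "A \<in> carrier R'"
  shows "ext_derivation d A = e A"
proof -
  obtain a s where as [simp]: "a \<in> carrier R" "s \<in> S" and a: "\<phi> s \<otimes>\<^bsub>R'\<^esub> A = \<phi> a"
    using fraction[of A] by auto
  have "\<phi> s \<odot>\<^bsub>N\<^esub> e A \<oplus>\<^bsub>N\<^esub> A \<odot>\<^bsub>N\<^esub> d s = d a"
    using derivation_mult[OF e, of "\<phi> s" A] by (simp add: a ed)
  then show ?thesis
    by (intro ext_derivation_eqI[OF d _ _ _ _ a]) (simp_all add: derivation_closed[OF e])
qed

end

lemma (in module_localization) ring_localization_ring_frac: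
  "ring_localization R (loc_ring R S) S (\<lambda>r. ring_frac R S r \<one>\<^bsub>R\<^esub>)"
proof (intro ring_localization.intro R.is_cring cring_loc_ring ring_localization_axioms.intro
    ring_hom_ring_frac Units_ring_frac)
  fix A
  assume "A \<in> carrier (loc_ring R S)"
  then obtain a s where as [simp]: "a \<in> carrier R" "s \<in> S" and A: "A = ring_frac R S a s"
    by (auto simp: loc_ring_carrier)
  have "ring_frac R S s \<one>\<^bsub>R\<^esub> \<otimes>\<^bsub>loc_ring R S\<^esub> A = ring_frac R S a \<one>\<^bsub>R\<^esub>"
    by (simp add: A loc_ring_mult ring_frac_eqI)
  then show "\<exists>a\<in>carrier R. \<exists>s\<in>S.
      ring_frac R S s \<one>\<^bsub>R\<^esub> \<otimes>\<^bsub>loc_ring R S\<^esub> A = ring_frac R S a \<one>\<^bsub>R\<^esub>"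
    using as by blast
next
  fix a b
  assume "a \<in> carrier R" "b \<in> carrier R" "ring_frac R S a \<one>\<^bsub>R\<^esub> = ring_frac R S b \<one>\<^bsub>R\<^esub>"
  then show "\<exists>u\<in>S. u \<otimes>\<^bsub>R\<^esub> a = u \<otimes>\<^bsub>R\<^esub> b"
    by (simp add: ring_frac_eq_iff)
qed (use S_carrier in auto)

section \<open>Extension of biderivations\<close>

text \<open>Here \<open>M'\<close> is any module over \<open>R'\<close> with a semilinear map from
  \<open>M\<close>; the localized module is inserted only in the final theorem.\<close>

locale biderivation_localization =
  ring_localization R R' S \<phi> + source: biderivation R M D + target: module R' M'
  for R :: "('a, 'c) ring_scheme" and R' :: "('b, 'e) ring_scheme" and S \<phi>
    and M :: "('a, 'm, 'd) module_scheme" and D and M' :: "('b, 'n, 'f) module_scheme" +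
  fixes \<psi> :: "'m \<Rightarrow> 'n"
  assumes semilinear: "semilinear R M M' \<phi> \<psi>"
begin

sublocale module_over_localization R R' S \<phi> M'
  by unfold_locales

lemma
  shows \<psi>_closed [simp]: "x \<in> carrier M \<Longrightarrow> \<psi> x \<in> carrier M'"
    and \<psi>_add: "x \<in> carrier M \<Longrightarrow> y \<in> carrier M \<Longrightarrow> \<psi> (x \<oplus>\<^bsub>M\<^esub> y) = \<psi> x \<oplus>\<^bsub>M'\<^esub> \<psi> y"
    and \<psi>_smult: "r \<in> carrier R \<Longrightarrow> x \<in> carrier M \<Longrightarrow> \<psi> (r \<odot>\<^bsub>M\<^esub> x) = \<phi> r \<odot>\<^bsub>M'\<^esub> \<psi> x"
  using semilinear by (auto simp: semilinear_def)

lemma D_closed [simp]: "r \<in> carrier R \<Longrightarrow> s \<in> carrier R \<Longrightarrow> D (r, s) \<in> carrier M"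
  using source.funcset by auto

lemma derivation_along_right:
  assumes [simp]: "r \<in> carrier R"
  shows "derivation_along R M' \<phi> (\<lambda>s. \<psi> (D (r, s)))"
  using source.derivation_right[OF assms]
  by (auto simp: derivation_def derivation_along_def \<psi>_add \<psi>_smult)

lemma D_left:
  assumes "r \<in> carrier R" "s \<in> carrier R" "t \<in> carrier R"
  shows "D (r \<oplus>\<^bsub>R\<^esub> s, t) = D (r, t) \<oplus>\<^bsub>M\<^esub> D (s, t)"
    and "D (r \<otimes>\<^bsub>R\<^esub> s, t) = r \<odot>\<^bsub>M\<^esub> D (s, t) \<oplus>\<^bsub>M\<^esub> s \<odot>\<^bsub>M\<^esub> D (r, t)"
  using derivation_add[OF source.derivation_left] derivation_mult[OF source.derivation_left] assms
  by auto

text \<open>First stage: the second argument is extended to \<open>R'\<close> while the first stays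
  in \<open>R\<close>. The argument \<open>B\<close> comes first so that \<open>ext_right B\<close>
  is the function of \<open>r\<close> to be extended next.\<close>

definition ext_right :: "'b \<Rightarrow> 'a \<Rightarrow> 'n"
  where "ext_right B r = ext_derivation (\<lambda>s. \<psi> (D (r, s))) B"

lemma ext_right_closed [simp]:
  "r \<in> carrier R \<Longrightarrow> B \<in> carrier R' \<Longrightarrow> ext_right B r \<in> carrier M'"
  by (simp add: ext_right_def ext_derivation_closed derivation_along_right)

lemma derivation_ext_right:
  "r \<in> carrier R \<Longrightarrow> derivation R' M' (\<lambda>B. ext_right B r)"
  unfolding ext_right_def
  by (rule derivation_ext_derivation[OF derivation_along_right])

lemma ext_right_image:
  "r \<in> carrier R \<Longrightarrow> s \<in> carrier R \<Longrightarrow> ext_right (\<phi> s) r = \<psi> (D (r, s))"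
  by (simp add: ext_right_def ext_derivation_image derivation_along_right)

lemma ext_right_unique:
  assumes "r \<in> carrier R" "derivation R' M' e"
    and "\<And>s. s \<in> carrier R \<Longrightarrow> e (\<phi> s) = \<psi> (D (r, s))" and "B \<in> carrier R'"
  shows "ext_right B r = e B"
  unfolding ext_right_def using assms by (intro ext_derivation_unique derivation_along_right)

text \<open>By uniqueness, the Leibniz rule in \<open>r\<close> only needs to be checked for \<open>B\<close> in the image of \<open>\<phi>\<close>.\<close>

lemma derivation_along_ext_right:
  assumes B [simp]: "B \<in> carrier R'"
  shows "derivation_along R M' \<phi> (ext_right B)"
proof -
  \<comment> \<open>The coefficients one give the sum the shape of
    \<open>derivation_lincomb\<close>.\<close>
  have "ext_right B (r \<oplus>\<^bsub>R\<^esub> s) = \<one>\<^bsub>R'\<^esub> \<odot>\<^bsub>M'\<^esub> ext_right B r \<oplus>\<^bsub>M'\<^esub> \<one>\<^bsub>R'\<^esub> \<odot>\<^bsub>M'\<^esub> ext_right B s"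
    if [simp]: "r \<in> carrier R" "s \<in> carrier R" for r s
    by (rule ext_right_unique[OF _ target.derivation_lincomb])
      (simp_all add: derivation_ext_right ext_right_image D_left \<psi>_add)
  moreover have "ext_right B (r \<otimes>\<^bsub>R\<^esub> s) =
      \<phi> r \<odot>\<^bsub>M'\<^esub> ext_right B s \<oplus>\<^bsub>M'\<^esub> \<phi> s \<odot>\<^bsub>M'\<^esub> ext_right B r"
    if [simp]: "r \<in> carrier R" "s \<in> carrier R" for r s
    by (rule ext_right_unique[OF _ target.derivation_lincomb])
      (simp_all add: derivation_ext_right ext_right_image D_left \<psi>_add \<psi>_smult)
  ultimately show ?thesis
    by (auto simp: derivation_along_def)
qed

text \<open>Second stage, in the first argument. The restriction to the carriers puts the function
  into the extensional function space in which biderivations live.\<close>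

definition ext_biderivation :: "'b \<times> 'b \<Rightarrow> 'n"
  where "ext_biderivation =
    (\<lambda>(A, B) \<in> carrier R' \<times> carrier R'. ext_derivation (ext_right B) A)"

lemma ext_biderivation_apply:
  "A \<in> carrier R' \<Longrightarrow> B \<in> carrier R' \<Longrightarrow>
    ext_biderivation (A, B) = ext_derivation (ext_right B) A"
  by (simp add: ext_biderivation_def)

lemma derivation_ext_biderivation_left:
  assumes B: "B \<in> carrier R'"
  shows "derivation R' M' (\<lambda>A. ext_biderivation (A, B))"
  by (rule loc.derivation_cong[OF derivation_ext_derivation[OF derivation_along_ext_right[OF B]]])
    (simp add: ext_biderivation_apply B)

text \<open>
  For \<open>A = a / s\<close> the quotient rule exhibits \<open>{A, -}\<close> as a linear combination of the derivations
  \<open>{a, -}\<close> and \<open>{s, -}\<close>.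
\<close>

lemma derivation_ext_biderivation_right:
  assumes A [simp]: "A \<in> carrier R'"
  shows "derivation R' M' (\<lambda>B. ext_biderivation (A, B))"
proof -
  obtain a s where as [simp]: "a \<in> carrier R" "s \<in> S" and a: "\<phi> s \<otimes>\<^bsub>R'\<^esub> A = \<phi> a"
    using fraction[OF A] by blast
  have u [simp]: "\<phi> s \<in> Units R'" by (simp add: Units_image)
  define i where "i = inv\<^bsub>R'\<^esub> (\<phi> s)"
  have i [simp]: "i \<in> carrier R'" and iu: "i \<otimes>\<^bsub>R'\<^esub> \<phi> s = \<one>\<^bsub>R'\<^esub>"
    by (simp_all add: i_def)
  \<comment> \<open>This is the quotient rule solved for the value at \<open>A\<close>. The point is
    that the coefficients do not depend on \<open>B\<close>.\<close>
  have "ext_biderivation (A, B) =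
      i \<odot>\<^bsub>M'\<^esub> ext_right B a \<oplus>\<^bsub>M'\<^esub> (\<ominus>\<^bsub>R'\<^esub> (i \<otimes>\<^bsub>R'\<^esub> A)) \<odot>\<^bsub>M'\<^esub> ext_right B s"
    if B [simp]: "B \<in> carrier R'" for B
  proof -
    let ?z = "ext_derivation (ext_right B) A"
    note d = derivation_along_ext_right[OF B]
    have z [simp]: "?z \<in> carrier M'"
      by (rule ext_derivation_closed[OF d A])
    have "i \<odot>\<^bsub>M'\<^esub> (\<phi> s \<odot>\<^bsub>M'\<^esub> ?z) = ?z"
      using target.smult_assoc1[of i "\<phi> s" ?z] by (simp add: iu)
    then have "i \<odot>\<^bsub>M'\<^esub> ext_right B a = ?z \<oplus>\<^bsub>M'\<^esub> (i \<otimes>\<^bsub>R'\<^esub> A) \<odot>\<^bsub>M'\<^esub> ext_right B s"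
      using ext_derivation_eq[OF d A as a, symmetric] by (simp add: target.smult_r_distr target.smult_assoc1)
    then show ?thesis
      by (simp add: ext_biderivation_apply target.smult_l_minus target.M.a_assoc target.M.r_neg)
  qed
  then show ?thesis
    by - (rule loc.derivation_cong[OF target.derivation_lincomb[of "\<lambda>B. ext_right B a"
        "\<lambda>B. ext_right B s" i "\<ominus>\<^bsub>R'\<^esub> (i \<otimes>\<^bsub>R'\<^esub> A)"]],
        simp_all add: derivation_ext_right)
qed

lemma biderivation_extension_ext_biderivation:
  "biderivation_extension R M D R' M' ext_biderivation \<phi> \<psi>"
proof -
  have "biderivation R' M' ext_biderivation"
  proof unfold_locales
    show "ext_biderivation \<in> carrier R' \<times> carrier R' \<rightarrow>\<^sub>E carrier M'"
      unfolding ext_biderivation_def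
      by (auto simp: ext_derivation_closed derivation_along_ext_right)
  qed (simp_all add: derivation_ext_biderivation_left derivation_ext_biderivation_right)
  then show ?thesis
    by (intro biderivation_extension.intro biderivation_extension_axioms.intro
        source.biderivation_axioms hom semilinear)
      (simp_all add: ext_biderivation_apply ext_derivation_image derivation_along_ext_right
        ext_right_image)
qed

text \<open>Uniqueness for derivations is used twice: it identifies \<open>D' (\<phi> r, -)\<close>
  with the first stage and then \<open>D' (-, B)\<close> with the second. Outside the carriers both
  functions are \<open>undefined\<close>.\<close>

lemma biderivation_extension_unique:
  assumes "biderivation_extension R M D R' M' D' \<phi> \<psi>"
  shows "D' = ext_biderivation"
proof -
  interpret E: biderivation_extension R M D R' M' D' \<phi> \<psi> by fact
  have right: "ext_right B r = D' (\<phi> r, B)" if "r \<in> carrier R" "B \<in> carrier R'" for r B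
    using that
    by (intro ext_right_unique[of r "\<lambda>B. D' (\<phi> r, B)"]) (auto simp: E.extends E.target.derivation_right)
  have "ext_derivation (ext_right B) A = D' (A, B)" if "A \<in> carrier R'" "B \<in> carrier R'" for A B
    using that
    by (intro ext_derivation_unique[where e = "\<lambda>A. D' (A, B)"])
      (auto simp: right derivation_along_ext_right E.target.derivation_left)
  then have "D' (A, B) = ext_biderivation (A, B)" for A B
    using E.target.funcset
    by (cases "A \<in> carrier R' \<and> B \<in> carrier R'")
      (auto simp: ext_biderivation_def PiE_arb[OF E.target.funcset])
  then show ?thesis by auto
qed

end

section \<open>Submodules \<open>I M\<close>, ideals and exchange of arguments\<close>

context module
begin

lemma ideal_smult_closed:
  assumes "I \<subseteq> carrier R" and "x \<in> ideal_smult M I"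
  shows "x \<in> carrier M"
  using assms(2) by induction (use assms(1) in auto)

lemma ideal_smult_smult:
  assumes I: "ideal I R" and r [simp]: "r \<in> carrier R" and "x \<in> ideal_smult M I"
  shows "r \<odot>\<^bsub>M\<^esub> x \<in> ideal_smult M I"
proof -
  interpret ideal I R by (rule I)
  show ?thesis
    using assms(3)
  proof induction
    case (smult i x)
    then show ?case
      using ideal_smult.smult[of "r \<otimes> i" I x M] by (simp add: smult_assoc1 I_l_closed)
  next
    case (add x y)
    then show ?case
      using ideal_smult_closed[OF a_subset] by (simp add: smult_r_distr ideal_smult.add)
  qed
qed

text \<open>The inductive definition provides sums but no negatives; these come from the scalar
  minus one, and \<open>x\<close> is recovered as \<open>(x + y) + (-1) y\<close>.\<close>

lemma ideal_smult_add_cancel: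
  assumes I: "ideal I R" and x [simp]: "x \<in> carrier M"
    and y: "y \<in> ideal_smult M I" and xy: "x \<oplus>\<^bsub>M\<^esub> y \<in> ideal_smult M I"
  shows "x \<in> ideal_smult M I"
proof -
  have [simp]: "y \<in> carrier M"
    using ideal_smult_closed[OF additive_subgroup.a_subset[OF ideal.axioms(1)[OF I]] y] .
  have "(\<ominus> \<one>) \<odot>\<^bsub>M\<^esub> y \<in> ideal_smult M I"
    by (rule ideal_smult_smult[OF I _ y]) simp
  then have "(x \<oplus>\<^bsub>M\<^esub> y) \<oplus>\<^bsub>M\<^esub> (\<ominus> \<one>) \<odot>\<^bsub>M\<^esub> y \<in> ideal_smult M I"
    by (rule ideal_smult.add[OF xy])
  then show ?thesis
    by (simp add: smult_l_minus M.a_assoc M.r_neg)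
qed

end

text \<open>Negatives are multiples by minus one, zero is a multiple of any element, and
  commutativity gives the other side of absorption.\<close>

lemma (in cring) idealI_mult_closed:
  assumes "J \<subseteq> carrier R" and "J \<noteq> {}"
    and add: "\<And>x y. x \<in> J \<Longrightarrow> y \<in> J \<Longrightarrow> x \<oplus> y \<in> J"
    and mult: "\<And>a x. a \<in> carrier R \<Longrightarrow> x \<in> J \<Longrightarrow> a \<otimes> x \<in> J"
  shows "ideal J R"
proof (rule idealI[OF ring_axioms])
  have carrier: "x \<in> J \<Longrightarrow> x \<in> carrier R" for x using assms(1) by auto
  have "\<ominus> x \<in> J" if "x \<in> J" for x
    using mult[of "\<ominus> \<one>" x] that carrier[OF that] by (simp add: l_minus)
  moreover have "\<zero> \<in> J"
    using assms(2) mult[of \<zero>] carrier by (metis all_not_in_conv l_null zero_closed)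
  ultimately show "subgroup J (add_monoid R)"
    using assms(1) add by (intro subgroup.intro) (auto simp flip: a_inv_def)
  show "a \<otimes> x \<in> J" if "a \<in> J" "x \<in> carrier R" for a x
    using mult[OF that(2,1)] m_comm[of a x] carrier that by simp
qed (rule mult)

text \<open>The axioms are symmetric in the two arguments. Exchanging them reduces the lifting
  condition on \<open>J\<close> to the one on \<open>I\<close>.\<close>

lemma (in biderivation) biderivation_swap: "biderivation R M (D \<circ> prod.swap)"
  using funcset derivation_left derivation_right
  by unfold_locales (auto simp: PiE_def extensional_def)

lemma (in biderivation_extension) biderivation_extension_swap:
  "biderivation_extension R M (D \<circ> prod.swap) R' M' (D' \<circ> prod.swap) \<phi> \<psi>"
  by (intro biderivation_extension.intro biderivation_extension_axioms.intro
      source.biderivation_swap target.biderivation_swap ring_hom semilinear)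
    (simp add: extends)

section \<open>The lifting property\<close>

context biderivation_localization
begin

text \<open>A generator \<open>i x\<close> is sent to \<open>\<phi> i\<close> times
  \<open>\<psi> x\<close>, with \<open>\<phi> i\<close> in the generated ideal, and
  \<open>\<psi>\<close> preserves sums.\<close>

lemma \<psi>_ideal_smult:
  assumes I: "ideal I R" and "x \<in> ideal_smult M I"
  shows "\<psi> x \<in> ideal_smult M' (Idl\<^bsub>R'\<^esub> (\<phi> ` I))"
proof -
  have sub: "I \<subseteq> carrier R"
    using I by (rule additive_subgroup.a_subset[OF ideal.axioms(1)])
  then have "\<phi> ` I \<subseteq> Idl\<^bsub>R'\<^esub> (\<phi> ` I)"
    by (intro loc.genideal_self) auto
  with assms(2) show ?thesis
  proof induction
    case (smult i x)
    then have "\<psi> (i \<odot>\<^bsub>M\<^esub> x) = \<phi> i \<odot>\<^bsub>M'\<^esub> \<psi> x" and "\<phi> i \<in> Idl\<^bsub>R'\<^esub> (\<phi> ` I)"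
      using sub by (auto intro!: \<psi>_smult)
    with smult show ?case
      by (simp add: ideal_smult.smult)
  next
    case (add x y)
    then show ?case
      using source.ideal_smult_closed[OF sub] by (auto simp: \<psi>_add intro!: ideal_smult.add)
  qed
qed

lemma lifting_left:
  assumes ext: "biderivation_extension R M D R' M' D' \<phi> \<psi>"
    and I: "ideal I R" and D: "D ` (I \<times> carrier R) \<subseteq> ideal_smult M I"
  shows "D' ` ((Idl\<^bsub>R'\<^esub> (\<phi> ` I)) \<times> carrier R') \<subseteq> ideal_smult M' (Idl\<^bsub>R'\<^esub> (\<phi> ` I))"
proof -
  interpret E: biderivation_extension R M D R' M' D' \<phi> \<psi> by fact
  interpret I: ideal I R by fact
  let ?I' = "Idl\<^bsub>R'\<^esub> (\<phi> ` I)"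
  have sub: "\<phi> ` I \<subseteq> carrier R'" by auto
  interpret I': ideal ?I' R' by (rule loc.genideal_ideal[OF sub])
  \<comment> \<open>Membership in \<open>?I'\<close> is part of \<open>?J\<close> because absorption
    requires it: in \<open>{A X, B} = A {X, B} + X {A, B}\<close> the last term lies in
    \<open>?I' M'\<close> since \<open>X\<close> is in \<open>?I'\<close>.\<close>
  let ?J = "{X \<in> ?I'. \<forall>B\<in>carrier R'. D' (X, B) \<in> ideal_smult M' ?I'}"
  \<comment> \<open>With \<open>B = b / t\<close>, the Leibniz rule for \<open>{\<phi> i, -}\<close>
    at \<open>\<phi> t\<close> times \<open>B\<close> leaves only values at elements of
    \<open>R\<close> besides \<open>?z\<close>. Hence \<open>\<phi> t\<close> times
    \<open>?z\<close> lies in the submodule, and the unit is removed.\<close>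
  have image: "D' (\<phi> i, B) \<in> ideal_smult M' ?I'" if i: "i \<in> I" and B [simp]: "B \<in> carrier R'" for i B
  proof -
    obtain b t where [simp]: "b \<in> carrier R" "t \<in> S" and b: "\<phi> t \<otimes>\<^bsub>R'\<^esub> B = \<phi> b"
      using fraction[OF B] by blast
    have [simp]: "i \<in> carrier R" using i by auto
    let ?z = "D' (\<phi> i, B)"
    have der: "derivation R' M' (\<lambda>B. D' (\<phi> i, B))"
      by (simp add: E.target.derivation_right)
    have z [simp]: "?z \<in> carrier M'" using derivation_closed[OF der B] .
    have mem: "D' (\<phi> i, \<phi> r) \<in> ideal_smult M' ?I'" if "r \<in> carrier R" for r
      using D i that by (auto simp flip: E.extends intro!: \<psi>_ideal_smult[OF I])
    have sum: "\<phi> t \<odot>\<^bsub>M'\<^esub> ?z \<oplus>\<^bsub>M'\<^esub> B \<odot>\<^bsub>M'\<^esub> D' (\<phi> i, \<phi> t) \<in> ideal_smult M' ?I'"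
      using derivation_mult[OF der, of "\<phi> t" B] mem[of b] by (simp add: b)
    have "B \<odot>\<^bsub>M'\<^esub> D' (\<phi> i, \<phi> t) \<in> ideal_smult M' ?I'"
      by (rule target.ideal_smult_smult[OF I'.ideal_axioms B mem]) simp
    with sum have tz: "\<phi> t \<odot>\<^bsub>M'\<^esub> ?z \<in> ideal_smult M' ?I'"
      by - (rule target.ideal_smult_add_cancel[OF I'.ideal_axioms], simp_all)
    have u [simp]: "\<phi> t \<in> Units R'" by (simp add: Units_image)
    have "inv\<^bsub>R'\<^esub> (\<phi> t) \<odot>\<^bsub>M'\<^esub> (\<phi> t \<odot>\<^bsub>M'\<^esub> ?z) = ?z"
      using target.smult_assoc1[of "inv\<^bsub>R'\<^esub> (\<phi> t)" "\<phi> t" ?z] by simp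
    then show ?thesis
      using target.ideal_smult_smult[OF I'.ideal_axioms _ tz, of "inv\<^bsub>R'\<^esub> (\<phi> t)"] by simp
  qed
  have "ideal ?J R'"
  proof (rule loc.idealI_mult_closed)
    show "?J \<subseteq> carrier R'" by auto
    have "\<phi> \<zero>\<^bsub>R\<^esub> \<in> ?J"
      using image loc.genideal_self[OF sub] by auto
    then show "?J \<noteq> {}" by blast
    show "X \<oplus>\<^bsub>R'\<^esub> Y \<in> ?J" if "X \<in> ?J" "Y \<in> ?J" for X Y
    proof -
      have "D' (X \<oplus>\<^bsub>R'\<^esub> Y, B) \<in> ideal_smult M' ?I'" if B: "B \<in> carrier R'" for B
        using derivation_add[OF E.target.derivation_left[OF B], of X Y] \<open>X \<in> ?J\<close> \<open>Y \<in> ?J\<close> B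
        by (simp add: ideal_smult.add)
      then show ?thesis using that by auto
    qed
    show "A \<otimes>\<^bsub>R'\<^esub> X \<in> ?J" if A: "A \<in> carrier R'" and X: "X \<in> ?J" for A X
    proof -
      have "D' (A \<otimes>\<^bsub>R'\<^esub> X, B) \<in> ideal_smult M' ?I'" if "B \<in> carrier R'" for B
      proof -
        have "D' (A, B) \<in> carrier M'"
          using E.target.funcset A that by auto
        then have "X \<odot>\<^bsub>M'\<^esub> D' (A, B) \<in> ideal_smult M' ?I'"
          using X by (intro ideal_smult.smult) auto
        moreover have "A \<odot>\<^bsub>M'\<^esub> D' (X, B) \<in> ideal_smult M' ?I'"
          using X that by (intro target.ideal_smult_smult[OF I'.ideal_axioms A]) auto
        ultimately show ?thesis
          using derivation_mult[OF E.target.derivation_left[OF that], of A X] A X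
          by (simp add: ideal_smult.add)
      qed
      then show ?thesis using A X by (auto intro: I'.I_l_closed)
    qed
  qed
  moreover have "\<phi> ` I \<subseteq> ?J"
    using image loc.genideal_self[OF sub] by auto
  ultimately have "?I' \<subseteq> ?J"
    by (rule loc.genideal_minimal)
  then show ?thesis by auto
qed

lemma lifting_right:
  assumes ext: "biderivation_extension R M D R' M' D' \<phi> \<psi>"
    and J: "ideal J R" and D: "D ` (carrier R \<times> J) \<subseteq> ideal_smult M J"
  shows "D' ` (carrier R' \<times> (Idl\<^bsub>R'\<^esub> (\<phi> ` J))) \<subseteq> ideal_smult M' (Idl\<^bsub>R'\<^esub> (\<phi> ` J))"
proof -
  interpret E: biderivation_extension R M D R' M' D' \<phi> \<psi> by fact
  \<comment> \<open>The swapped biderivation satisfies the same locale assumptions, so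
    \<open>lifting_left\<close> applies to it.\<close>
  interpret swap: biderivation_localization R R' S \<phi> M "D \<circ> prod.swap" M' \<psi>
    by (intro biderivation_localization.intro ring_localization_axioms source.biderivation_swap
        target.module_axioms biderivation_localization_axioms.intro semilinear)
  have "(D \<circ> prod.swap) ` (J \<times> carrier R) \<subseteq> ideal_smult M J"
    using D by (auto simp: image_subset_iff)
  from swap.lifting_left[OF E.biderivation_extension_swap J this] show ?thesis
    by (auto simp: image_subset_iff)
qed

lemma lifting_extension:
  assumes ext: "biderivation_extension R M D R' M' D' \<phi> \<psi>"
  shows "lifting_extension R M D R' M' D' \<phi> \<psi>"
proof (intro lifting_extension.intro ext lifting_extension_axioms.intro)
  fix I J
  assume pair: "bidifferential_ideal_pair R M D I J"
  then have "I \<subseteq> carrier R" "J \<subseteq> carrier R"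
    by (auto simp: bidifferential_ideal_pair_def dest: ideal.Icarr)
  then have "ideal (Idl\<^bsub>R'\<^esub> (\<phi> ` I)) R'" "ideal (Idl\<^bsub>R'\<^esub> (\<phi> ` J)) R'"
    by (auto intro!: loc.genideal_ideal)
  then show "bidifferential_ideal_pair R' M' D' (Idl\<^bsub>R'\<^esub> (\<phi> ` I)) (Idl\<^bsub>R'\<^esub> (\<phi> ` J))"
    using pair lifting_left[OF ext] lifting_right[OF ext]
    by (simp add: bidifferential_ideal_pair_def)
qed

end

theorem theorem2p8:
  fixes R :: "('a, 'c) ring_scheme" and M :: "('a, 'm, 'd) module_scheme"
    and D :: "'a \<times> 'a \<Rightarrow> 'm" and \<Sigma> :: "'a set"
  assumes "cring R" and "module R M" and "biderivation R M D"
    and "submonoid \<Sigma> R" and "\<Sigma> \<subseteq> carrier R - {\<zero>\<^bsub>R\<^esub>}"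
  defines "R' \<equiv> loc_ring R \<Sigma>"
    and "M' \<equiv> loc_module R M \<Sigma>"
    and "\<phi> \<equiv> (\<lambda>r. ring_frac R \<Sigma> r \<one>\<^bsub>R\<^esub>)"
    and "\<psi> \<equiv> (\<lambda>x. module_frac M \<Sigma> x \<one>\<^bsub>R\<^esub>)"
  shows "(\<exists>!D'. biderivation_extension R M D R' M' D' \<phi> \<psi>) \<and>
    (\<forall>D'. biderivation_extension R M D R' M' D' \<phi> \<psi> \<longrightarrow> lifting_extension R M D R' M' D' \<phi> \<psi>)"
proof -
  interpret B: biderivation R M D by fact
  interpret L: module_localization R M \<Sigma>
    by (intro module_localization.intro module_localization_axioms.intro assms)
  \<comment> \<open>The concrete fractions are shown to satisfy the abstract description; from here
    on the general results apply.\<close>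
  have "biderivation_localization R R' \<Sigma> \<phi> M D M' \<psi>"
    unfolding R'_def M'_def \<phi>_def \<psi>_def
    by (intro biderivation_localization.intro biderivation_localization_axioms.intro
        L.ring_localization_ring_frac L.module_loc_module L.semilinear_module_frac B.biderivation_axioms)
  then interpret biderivation_localization R R' \<Sigma> \<phi> M D M' \<psi> .
  show ?thesis
    using biderivation_extension_ext_biderivation biderivation_extension_unique lifting_extension
    by blast
qed

end
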